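(* Suppose we are given infinite words $\alpha\in\Sigma_1^\omega$, $\beta\in\Sigma_2^\omega$, a deterministic finite Muller automaton $\mathcal{A}$ over $\Sigma_1$, and an oracle that, given a morphism $h\colon\Sigma_1^*\to M$ into a finite monoid $M$, computes a transducer $\mathcal{T}$ with input alphabet $\Sigma_2$ and output alphabet $M$ with the following property: there exists a factorisation $\alpha=w_0w_1w_2\cdots$ into finite words $w_n$ such that $\mathcal{T}(\beta)=h(w_0)h(w_1)h(w_2)\cdots$. Then we can compute a deterministic finite Muller automaton $\mathcal{B}$ over $\Sigma_2$ such that $\alpha\in L(\mathcal{A})\Leftrightarrow\beta\in L(\mathcal{B})$.
   Context: A deterministic finite Muller automaton over $\Sigma$ is $(Q,q_{\mathrm{init}},\delta,\mathcal{F})$ with finite $Q$, $\delta\colon Q\times\Sigma\to Q$, $\mathcal{F}\subseteq 2^Q$; it accepts $\alpha\in\Sigma^\omega$ iff the set of states occurring infinitely often in its run on $\alpha$ belongs to $\mathcal{F}$; $L(\mathcal{A})$ is its set of accepted words. A (deterministic finite) transducer with input alphabet $\Sigma$ and output alphabet $\Gamma$ is $(R,r_{\mathrm{init}},\sigma)$ with finite $R$ and $\sigma\colon R\times\Sigma\to R\times\Gamma^*$; on input $\beta\in\Sigma^\omega$ it reads letters one by one, changing state and emitting a finite word at each step, and $\mathcal{T}(\beta)$ is the concatenation of the emitted words. Words are given by oracles computing $\alpha(n)$ from $n$. *)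

theory Defs
  imports
    "HOL-Library.Omega_Words_Fun"
    "HOL-Library.Nat_Bijection"
    "HOL-Algebra.Group"
begin

section \<open>Computability relative to oracles\<close>

text \<open>
  Partial recursive functionals in Kleene's sense: terms of the usual calculus of \<open>\<mu>\<close>-recursive
  functions, with an additional basic function for every oracle. The oracles are parameters of the
  evaluation relation and not part of a term, so one term is one algorithm for all oracles.
  A term without a value on given arguments diverges on them.
\<close>

datatype recf =
    Zero
  | Succ
  | Proj nat
  | Oracle nat
  | Comp recf "recf list"
  | PrimRec recf recf
  | Mu recf

inductive computes :: "(nat \<Rightarrow> nat) list \<Rightarrow> recf \<Rightarrow> nat list \<Rightarrow> nat \<Rightarrow> bool" for orcs where
  Zero: "computes orcs Zero xs 0"
| Succ: "computes orcs Succ [x] (Suc x)"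
| Proj: "i < length xs \<Longrightarrow> computes orcs (Proj i) xs (xs ! i)"
| Oracle: "i < length orcs \<Longrightarrow> computes orcs (Oracle i) [x] ((orcs ! i) x)"
| Comp: "length ys = length gs \<Longrightarrow> (\<And>i. i < length gs \<Longrightarrow> computes orcs (gs ! i) xs (ys ! i)) \<Longrightarrow>
    computes orcs f ys z \<Longrightarrow> computes orcs (Comp f gs) xs z"
| PrimRec_0: "computes orcs f xs y \<Longrightarrow> computes orcs (PrimRec f g) (0 # xs) y"
| PrimRec_Suc: "computes orcs (PrimRec f g) (n # xs) y \<Longrightarrow> computes orcs g (n # y # xs) z \<Longrightarrow>
    computes orcs (PrimRec f g) (Suc n # xs) z"
| Mu: "computes orcs f (n # xs) 0 \<Longrightarrow> (\<And>m. m < n \<Longrightarrow> \<exists>y. computes orcs f (m # xs) (Suc y)) \<Longrightarrow>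
    computes orcs (Mu f) xs n"

inductive_cases computes_elims:
  "computes orcs Zero xs y"
  "computes orcs Succ xs y"
  "computes orcs (Proj i) xs y"
  "computes orcs (Oracle i) xs y"
  "computes orcs (Comp f gs) xs y"
  "computes orcs (PrimRec f g) (0 # xs) y"
  "computes orcs (PrimRec f g) (Suc n # xs) y"
  "computes orcs (Mu f) xs y"

lemma computes_functional:
  assumes "computes orcs p xs y" and "computes orcs p xs z"
  shows "y = z"
  using assms
proof (induction arbitrary: z rule: computes.induct)
  case Zero
  then show ?case by (rule computes_elims(1)) simp
next
  case Succ
  then show ?case by (rule computes_elims(2)) simp
next
  case Proj
  from Proj.prems show ?case by (rule computes_elims(3)) simp
next
  case Oracle
  from Oracle.prems show ?case by (rule computes_elims(4)) simp
next
  case (Comp ys gs xs f y)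
  from Comp.prems obtain zs where zs: "length zs = length gs"
    "\<And>i. i < length gs \<Longrightarrow> computes orcs (gs ! i) xs (zs ! i)" "computes orcs f zs z"
    by (rule computes_elims(5)) blast
  have "ys = zs"
    using Comp.hyps Comp.IH(1) zs(1,2) by (intro nth_equalityI) simp_all
  with Comp.IH(2) zs(3) show ?case by simp
next
  case (PrimRec_0 f xs y g)
  from PrimRec_0.prems have "computes orcs f xs z"
    by (rule computes_elims(6))
  then show ?case by (rule PrimRec_0.IH)
next
  case (PrimRec_Suc f g n xs y w)
  from PrimRec_Suc.prems obtain u where
    u: "computes orcs (PrimRec f g) (n # xs) u" "computes orcs g (n # u # xs) z"
    by (rule computes_elims(7)) blast
  from PrimRec_Suc.IH(1)[OF u(1)] u(2) have "computes orcs g (n # y # xs) z" by simp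
  then show ?case by (rule PrimRec_Suc.IH(2))
next
  case (Mu f n xs)
  from Mu.prems have z: "computes orcs f (z # xs) 0"
    "\<forall>m<z. \<exists>y. computes orcs f (m # xs) (Suc y)"
    by (rule computes_elims(8), simp)+
  have "\<not> n < z"
    using z(2) Mu.IH(1) by (metis nat.distinct(1))
  moreover have "\<not> z < n"
    using z(1) Mu.IH(2) by (metis nat.distinct(1))
  ultimately show ?case by simp
qed


section \<open>Infinite concatenation of finite words\<close>

text \<open>
  The concatenation of infinitely many finite words may be finite or infinite. It is represented as
  a function into \<open>option\<close> that is \<open>None\<close> from the end of the word on; it equals
  \<open>Some \<circ> \<gamma>\<close> iff it is the infinite word \<open>\<gamma>\<close>.
\<close>

definition word_concat :: "(nat \<Rightarrow> 'a list) \<Rightarrow> nat \<Rightarrow> 'a option" where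
  "word_concat u k =
    (if \<exists>n. k < length (concat (map u [0..<n]))
     then Some (concat (map u [0..<(LEAST n. k < length (concat (map u [0..<n])))]) ! k)
     else None)"


section \<open>Deterministic Muller automata\<close>

record ('q, 'a) muller =
  mstates :: "'q set"
  minit :: 'q
  mtrans :: "'q \<Rightarrow> 'a \<Rightarrow> 'q"
  macc :: "'q set set"

definition muller_automaton :: "'a set \<Rightarrow> ('q, 'a) muller \<Rightarrow> bool" where
  "muller_automaton \<Sigma> A \<longleftrightarrow>
     finite (mstates A) \<and> minit A \<in> mstates A \<and>
     (\<forall>q\<in>mstates A. \<forall>a\<in>\<Sigma>. mtrans A q a \<in> mstates A) \<and>
     macc A \<subseteq> Pow (mstates A)"

primrec muller_run :: "('q, 'a) muller \<Rightarrow> 'a word \<Rightarrow> 'q word" where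
  "muller_run A \<alpha> 0 = minit A"
| "muller_run A \<alpha> (Suc n) = mtrans A (muller_run A \<alpha> n) (\<alpha> n)"

definition muller_lang :: "'a set \<Rightarrow> ('q, 'a) muller \<Rightarrow> 'a word set" where
  "muller_lang \<Sigma> A = {\<alpha>. range \<alpha> \<subseteq> \<Sigma> \<and> limit (muller_run A \<alpha>) \<in> macc A}"


section \<open>Transducers\<close>

record ('r, 'a, 'b) transducer =
  tstates :: "'r set"
  tinit :: 'r
  tstep :: "'r \<Rightarrow> 'a \<Rightarrow> 'r \<times> 'b list"

definition finite_transducer :: "'a set \<Rightarrow> 'b set \<Rightarrow> ('r, 'a, 'b) transducer \<Rightarrow> bool" where
  "finite_transducer \<Sigma> \<Gamma> T \<longleftrightarrow>
     finite (tstates T) \<and> tinit T \<in> tstates T \<and>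
     (\<forall>r\<in>tstates T. \<forall>a\<in>\<Sigma>. tstep T r a \<in> tstates T \<times> lists \<Gamma>)"

primrec transducer_run :: "('r, 'a, 'b) transducer \<Rightarrow> 'a word \<Rightarrow> 'r word" where
  "transducer_run T \<beta> 0 = tinit T"
| "transducer_run T \<beta> (Suc n) = fst (tstep T (transducer_run T \<beta> n) (\<beta> n))"

definition transducer_output :: "('r, 'a, 'b) transducer \<Rightarrow> 'a word \<Rightarrow> nat \<Rightarrow> 'b option" where
  "transducer_output T \<beta> = word_concat (\<lambda>n. snd (tstep T (transducer_run T \<beta> n) (\<beta> n)))"


section \<open>Morphisms into monoids\<close>

definition free_monoid :: "'a set \<Rightarrow> 'a list monoid" where
  "free_monoid \<Sigma> = \<lparr>carrier = lists \<Sigma>, mult = (@), one = []\<rparr>"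

definition monoid_morphism :: "'a set \<Rightarrow> 'm monoid \<Rightarrow> ('a list \<Rightarrow> 'm) \<Rightarrow> bool" where
  "monoid_morphism \<Sigma> M h \<longleftrightarrow> h \<in> hom (free_monoid \<Sigma>) M \<and> h [] = \<one>\<^bsub>M\<^esub>"


section \<open>Presentation of finite objects by natural numbers\<close>

text \<open>
  To be handed to an algorithm, a finite alphabet, state set or monoid is presented with an initial
  segment \<open>{..<n}\<close> of the natural numbers as its underlying set. Functions on initial segments are
  coded by their value tables. A morphism is coded by the multiplication table and the unit of the
  monoid together with the images of the letters.
\<close>

definition table_code :: "nat \<Rightarrow> nat \<Rightarrow> (nat \<Rightarrow> nat \<Rightarrow> nat) \<Rightarrow> nat" where
  "table_code m n f = list_encode (map (\<lambda>i. list_encode (map (f i) [0..<n])) [0..<m])"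

definition muller_code :: "nat \<Rightarrow> (nat, nat) muller \<Rightarrow> nat" where
  "muller_code k A =
     list_encode
       [card (mstates A), minit A, table_code (card (mstates A)) k (mtrans A),
        set_encode (set_encode ` macc A)]"

definition transducer_code :: "nat \<Rightarrow> (nat, nat, nat) transducer \<Rightarrow> nat" where
  "transducer_code k T =
     list_encode
       [card (tstates T), tinit T,
        table_code (card (tstates T)) k
          (\<lambda>r a. prod_encode (fst (tstep T r a), list_encode (snd (tstep T r a))))]"

definition morphism_code :: "nat \<Rightarrow> nat monoid \<Rightarrow> (nat list \<Rightarrow> nat) \<Rightarrow> nat" where
  "morphism_code k M h =
     list_encode
       [card (carrier M), table_code (card (carrier M)) (card (carrier M)) (mult M), \<one>\<^bsub>M\<^esub>,
        list_encode (map (\<lambda>a. h [a]) [0..<k])]"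

text \<open>
  The alphabets are \<open>{..<k1}\<close> and \<open>{..<k2}\<close>. Nothing is required of the oracle on numbers that do not
  code a morphism, and the words of the factorisation are allowed to be empty.
\<close>

definition transducer_oracle ::
    "nat \<Rightarrow> nat \<Rightarrow> nat word \<Rightarrow> nat word \<Rightarrow> (nat \<Rightarrow> nat) \<Rightarrow> bool" where
  "transducer_oracle k1 k2 \<alpha> \<beta> orc \<longleftrightarrow>
     (\<forall>m (M :: nat monoid) h.
        monoid M \<and> carrier M = {..<m} \<and> monoid_morphism {..<k1} M h \<longrightarrow>
        (\<exists>r T. finite_transducer {..<k2} (carrier M) T \<and> tstates T = {..<r} \<and>
           orc (morphism_code k1 M h) = transducer_code k2 T \<and>
           (\<exists>w. (\<forall>n. w n \<in> lists {..<k1}) \<and>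
                word_concat w = Some \<circ> \<alpha> \<and>
                transducer_output T \<beta> = Some \<circ> (\<lambda>n. h (w n)))))"

end

theory Submission
  imports Defs
begin

text \<open>
  Let \<open>A\<close> have state set \<open>{..<n}\<close>. Each letter acts on the pairs \<open>(q, S)\<close> of a state and a set of states by
  moving \<open>q\<close> along the transition and adding the new state to \<open>S\<close>; this is a morphism \<open>h\<close> into the
  full transformation monoid on these pairs. Let \<open>T\<close> be the transducer for \<open>h\<close>. The automaton \<open>B\<close>
  simulates \<open>T\<close> on \<open>\<beta>\<close> and keeps a pair \<open>(q, S)\<close>; in each step it resets \<open>S\<close> to the empty set and applies the
  monoid elements emitted by \<open>T\<close>, so that \<open>S\<close> becomes the set of states that \<open>A\<close> visits on the
  corresponding factor of \<open>\<alpha>\<close>. Hence the states visited infinitely often by \<open>A\<close> are the union of the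
  sets \<open>S\<close> occurring in the states visited infinitely often by \<open>B\<close>, which turns the Muller condition
  of \<open>A\<close> into one for \<open>B\<close>. The construction is primitive recursive with a single oracle query.
\<close>

section \<open>Primitive recursive functions\<close>

text \<open>A fixed arity is demanded because one term has to serve all assignments, and it
  addresses its arguments by position.\<close>

definition uniform_length :: "('e \<Rightarrow> nat list) \<Rightarrow> bool" where
  "uniform_length v \<longleftrightarrow> (\<exists>k. \<forall>e. length (v e) = k)"

text \<open>
  \<open>prec v f\<close>: the number \<open>f e\<close> is computed, uniformly in \<open>e\<close> and without oracle queries, from the
  numbers listed in \<open>v e\<close>. Here \<open>e\<close> is a variable assignment; a binder extends it by pairing and
  \<open>v\<close> by a new first entry, as in \<open>\<lambda>p. fst p # v (snd p)\<close>.
\<close>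

definition prec :: "('e \<Rightarrow> nat list) \<Rightarrow> ('e \<Rightarrow> nat) \<Rightarrow> bool" where
  "prec v f \<longleftrightarrow> uniform_length v \<and> (\<exists>p. \<forall>orcs e. computes orcs p (v e) (f e))"

lemma prec_imp_uniform_length: "prec v f \<Longrightarrow> uniform_length v"
  by (simp add: prec_def)

lemma uniform_length_Nil: "uniform_length (\<lambda>e. [])"
  by (simp add: uniform_length_def)

lemma uniform_length_Cons: "uniform_length v \<Longrightarrow> uniform_length (\<lambda>e. x e # v e)"
  by (auto simp: uniform_length_def)

lemma uniform_length_reindex: "uniform_length v \<Longrightarrow> uniform_length (\<lambda>e. v (d e))"
  by (auto simp: uniform_length_def)

lemma prec_reindex: "prec v f \<Longrightarrow> prec (\<lambda>e. v (d e)) (\<lambda>e. f (d e))"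
  unfolding prec_def uniform_length_def by blast

text \<open>The term is \<open>Comp\<close> of the term for \<open>g\<close> with those for
  \<open>fs\<close>. The map \<open>d\<close> translates between assignments, so weakening and the
  instantiation of bound variables become instances of this rule.\<close>

lemma prec_compose:
  assumes g: "prec w g" and fs: "\<And>f. f \<in> set fs \<Longrightarrow> prec v f" and v: "uniform_length v"
    and args: "\<And>e. w (d e) = map (\<lambda>f. f e) fs"
  shows "prec v (\<lambda>e. g (d e))"
proof -
  obtain p where p: "\<And>orcs e. computes orcs p (w e) (g e)"
    using g by (auto simp: prec_def)
  have "\<forall>f\<in>set fs. \<exists>q. \<forall>orcs e. computes orcs q (v e) (f e)"
    using fs by (auto simp: prec_def)
  then obtain c where c: "\<And>f orcs e. f \<in> set fs \<Longrightarrow> computes orcs (c f) (v e) (f e)"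
    by metis
  have "computes orcs (Comp p (map c fs)) (v e) (g (d e))" for orcs e
    by (rule computes.Comp[where ys = "map (\<lambda>f. f e) fs"])
      (auto intro: c p[of _ "d e", unfolded args])
  with v show ?thesis
    by (auto simp: prec_def)
qed

lemma prec_nth:
  assumes "uniform_length v" and "\<And>e. i < length (v e)"
  shows "prec v (\<lambda>e. v e ! i)"
  unfolding prec_def using assms by (blast intro: computes.Proj)

lemma prec_var_hd:
  assumes "uniform_length v"
  shows "prec (\<lambda>e. x e # v e) x"
  using prec_nth[of "\<lambda>e. x e # v e" 0] assms by (simp add: uniform_length_Cons)

text \<open>Weakening: the entries of \<open>v\<close> are reached by projections shifted by the
  length of \<open>u\<close>.\<close>

lemma prec_append_left:
  assumes f: "prec v f" and u: "uniform_length u"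
  shows "prec (\<lambda>e. u e @ v e) f"
proof -
  obtain j k where jk: "\<And>e. length (u e) = j" "\<And>e. length (v e) = k"
    using f u by (auto simp: prec_def uniform_length_def)
  then have unif: "uniform_length (\<lambda>e. u e @ v e)"
    by (auto simp: uniform_length_def)
  show ?thesis
  proof (rule prec_compose[OF f, where d = "\<lambda>e. e" and fs = "map (\<lambda>i e. (u e @ v e) ! i) [j..<j + k]"])
    show "v e = map (\<lambda>f. f e) (map (\<lambda>i e. (u e @ v e) ! i) [j..<j + k])" for e
      by (rule nth_equalityI) (simp_all add: jk nth_append)
    show "prec (\<lambda>e. u e @ v e) f" if "f \<in> set (map (\<lambda>i e. (u e @ v e) ! i) [j..<j + k])" for f
      using that unif jk by (auto intro!: prec_nth)
  qed (rule unif)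
qed

lemma prec_var_tl:
  assumes "prec v f"
  shows "prec (\<lambda>e. x e # v e) f"
  using prec_append_left[OF assms, of "\<lambda>e. [x e]"] by (simp add: uniform_length_def)

section \<open>Basic functions and primitive recursion\<close>

lemma prec_0: "uniform_length v \<Longrightarrow> prec v (\<lambda>e. 0)"
  unfolding prec_def by (blast intro: computes.Zero)

lemma prec_Suc:
  assumes "prec v a"
  shows "prec v (\<lambda>e. Suc (a e))"
proof -
  have "prec (\<lambda>x. [x]) Suc"
    unfolding prec_def uniform_length_def by (auto intro: computes.Succ)
  from prec_compose[OF this, where d = a and v = v and fs = "[a]"] show ?thesis
    using assms by (simp add: prec_imp_uniform_length)
qed

lemma prec_const:
  assumes "uniform_length v"
  shows "prec v (\<lambda>e. c)"
  by (induction c) (use assms in \<open>auto intro: prec_0 prec_Suc\<close>)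

text \<open>The list in the hypothesis on \<open>g\<close> follows \<open>PrimRec_Suc\<close>, which
  passes the counter, the previous value and the parameters in this order.\<close>

lemma prec_rec_nat:
  assumes b: "prec v b" and n: "prec v n"
    and g: "prec (\<lambda>p. fst p # fst (snd p) # v (snd (snd p)))
              (\<lambda>p. g (fst p) (fst (snd p)) (snd (snd p)))"
  shows "prec v (\<lambda>e. rec_nat (b e) (\<lambda>i y. g i y e) (n e))"
proof -
  obtain pb where pb: "\<And>orcs e. computes orcs pb (v e) (b e)"
    using b by (auto simp: prec_def)
  obtain pg where pg: "\<And>orcs i y e. computes orcs pg (i # y # v e) (g i y e)"
    using g by (auto simp: prec_def)
  have "computes orcs (PrimRec pb pg) (m # v e) (rec_nat (b e) (\<lambda>i y. g i y e) m)" for orcs e m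
    by (induction m) (auto intro: computes.PrimRec_0 computes.PrimRec_Suc pb pg)
  then have rec: "prec (\<lambda>p. fst p # v (snd p)) (\<lambda>p. rec_nat (b (snd p)) (\<lambda>i y. g i y (snd p)) (fst p))"
    using b by (auto simp: prec_def intro: uniform_length_Cons uniform_length_reindex)
  obtain k where k: "\<And>e. length (v e) = k"
    using b by (auto simp: prec_def uniform_length_def)
  have v: "uniform_length v"
    using b by (rule prec_imp_uniform_length)
  have "prec v (\<lambda>e. (\<lambda>p. rec_nat (b (snd p)) (\<lambda>i y. g i y (snd p)) (fst p)) (n e, e))"
  proof (rule prec_compose[OF rec, where fs = "n # map (\<lambda>i e. v e ! i) [0..<k]"])
    show "fst (n e, e) # v (snd (n e, e)) = map (\<lambda>f. f e) (n # map (\<lambda>i e. v e ! i) [0..<k])" for e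
      using k by (auto intro: nth_equalityI)
    show "prec v f" if "f \<in> set (n # map (\<lambda>i e. v e ! i) [0..<k])" for f
      using that n v k by (auto intro!: prec_nth)
  qed (rule v)
  then show ?thesis by simp
qed

text \<open>Instantiates the bound variable of \<open>g\<close> by \<open>a\<close> in a longer
  context. The prefix \<open>u\<close> holds the additional variables, such as the counter and the
  accumulator of an enclosing recursion.\<close>

lemma prec_subst:
  assumes g: "prec (\<lambda>p. fst p # v (snd p)) (\<lambda>p. g (fst p) (snd p))" and a: "prec w a"
    and w: "\<And>e. w e = u e @ v (d e)" and u: "uniform_length u"
  shows "prec w (\<lambda>e. g (a e) (d e))"
proof -
  have unif: "uniform_length w"
    using a by (rule prec_imp_uniform_length)
  obtain j where j: "\<And>e. length (u e) = j"
    using u by (auto simp: uniform_length_def)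
  obtain k where "\<And>p :: nat \<times> _. length (fst p # v (snd p)) = k"
    using g by (auto simp: prec_def uniform_length_def)
  \<comment> \<open>\<open>k\<close> also counts the bound variable, so the parameters fill
    \<open>k - 1\<close> positions.\<close>
  from this[of "(0, e)" for e] have k: "length (v e) = k - 1" for e
    by (metis One_nat_def diff_Suc_1 length_Cons snd_conv)
  have "prec w (\<lambda>e. (\<lambda>p. g (fst p) (snd p)) (a e, d e))"
  proof (rule prec_compose[OF g, where fs = "a # map (\<lambda>i e. w e ! i) [j..<j + (k - 1)]"])
    show "fst (a e, d e) # v (snd (a e, d e)) =
        map (\<lambda>f. f e) (a # map (\<lambda>i e. w e ! i) [j..<j + (k - 1)])" for e
      using j k by (auto intro!: nth_equalityI simp: w nth_append)
    show "prec w f" if "f \<in> set (a # map (\<lambda>i e. w e ! i) [j..<j + (k - 1)])" for f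
      using that a unif by (auto intro!: prec_nth) (simp add: w j k)
  qed (rule unif)
  then show ?thesis by simp
qed

named_theorems prec_intros

lemmas [prec_intros] = uniform_length_Nil uniform_length_Cons prec_const prec_Suc prec_rec_nat

section \<open>Arithmetic and iteration\<close>

lemma prec_add [prec_intros]:
  assumes "prec v a" and "prec v b"
  shows "prec v (\<lambda>e. a e + b e)"
proof -
  \<comment> \<open>The hypotheses are reindexed so that they apply below binders, where the
    assignment is a tuple containing \<open>e\<close>.\<close>
  note [prec_intros] = assms[THEN prec_reindex]
    assms(1)[THEN prec_imp_uniform_length, THEN uniform_length_reindex]
  have *: "x + y = rec_nat x (\<lambda>i z. Suc z) y" for x y :: nat
    by (induction y) simp_all
  show ?thesis
    unfolding * by (rule prec_var_hd prec_intros | rule prec_var_tl)+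
qed

lemma prec_mult [prec_intros]:
  assumes "prec v a" and "prec v b"
  shows "prec v (\<lambda>e. a e * b e)"
proof -
  note [prec_intros] = assms[THEN prec_reindex]
    assms(1)[THEN prec_imp_uniform_length, THEN uniform_length_reindex]
  have *: "x * y = rec_nat 0 (\<lambda>i z. z + x) y" for x y :: nat
    by (induction y) simp_all
  show ?thesis
    unfolding * by (rule prec_var_hd prec_intros | rule prec_var_tl)+
qed

lemma prec_diff [prec_intros]:
  assumes "prec v a" and "prec v b"
  shows "prec v (\<lambda>e. a e - b e)"
proof -
  note [prec_intros] = assms[THEN prec_reindex]
    assms(1)[THEN prec_imp_uniform_length, THEN uniform_length_reindex]
  \<comment> \<open>The predecessor arises from a recursion that returns its counter and ignores the
    previous value; iterating it gives truncated subtraction.\<close>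
  have pred: "x - Suc 0 = rec_nat 0 (\<lambda>i z. i) x" for x :: nat
    by (cases x) simp_all
  have "x - y = rec_nat x (\<lambda>i z. z - Suc 0) y" for x y :: nat
    by (induction y) simp_all
  then have *: "x - y = rec_nat x (\<lambda>i z. rec_nat 0 (\<lambda>i z. i) z) y" for x y :: nat
    by (simp add: pred)
  show ?thesis
    unfolding * by (rule prec_var_hd prec_intros | rule prec_var_tl)+
qed

lemma prec_power [prec_intros]:
  assumes "prec v a" and "prec v b"
  shows "prec v (\<lambda>e. a e ^ b e)"
proof -
  note [prec_intros] = assms[THEN prec_reindex]
    assms(1)[THEN prec_imp_uniform_length, THEN uniform_length_reindex]
  have *: "x ^ y = rec_nat 1 (\<lambda>i z. x * z) y" for x y :: nat
    by (induction y) simp_all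
  show ?thesis
    unfolding * by (rule prec_var_hd prec_intros | rule prec_var_tl)+
qed

lemma prec_funpow [prec_intros]:
  assumes "prec v x" and "prec v n"
    and "prec (\<lambda>p. fst p # v (snd p)) (\<lambda>p. g (fst p) (snd p))"
  shows "prec v (\<lambda>e. ((\<lambda>y. g y e) ^^ n e) (x e))"
proof -
  have *: "(f ^^ k) y = rec_nat y (\<lambda>i. f) k" for f :: "nat \<Rightarrow> nat" and k y
    by (induction k) simp_all
  show ?thesis
    unfolding * using assms(1,2)
    by (rule prec_rec_nat)
      (rule prec_reindex[OF assms(3), THEN prec_var_tl, where d1 = "snd"])
qed

section \<open>Bounded sums, decidable predicates and division\<close>

lemma prec_sum [prec_intros]:
  assumes n: "prec v n" and g: "prec (\<lambda>p. fst p # v (snd p)) (\<lambda>p. g (fst p) (snd p))"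
  shows "prec v (\<lambda>e. \<Sum>i<n e. g i e)"
proof -
  note unif = n[THEN prec_imp_uniform_length, THEN uniform_length_reindex]
  have *: "(\<Sum>i<k. f i) = rec_nat 0 (\<lambda>i z. z + f i) k" for f :: "nat \<Rightarrow> nat" and k
    by (induction k) simp_all
  \<comment> \<open>The recursion places the accumulator between the counter and the parameters. It
    is skipped by taking both as the prefix \<open>u\<close> and substituting the counter for the
    bound variable.\<close>
  have body: "prec (\<lambda>p. fst p # fst (snd p) # v (snd (snd p))) (\<lambda>p. g (fst p) (snd (snd p)))"
    by (rule prec_subst[OF g, where u = "\<lambda>p. [fst p, fst (snd p)]"])
      (auto intro!: prec_var_hd uniform_length_Cons uniform_length_Nil unif)
  show ?thesis
    unfolding * by (rule n unif body prec_var_hd prec_intros | rule prec_var_tl)+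
qed

lemma prec_of_bool_le [prec_intros]:
  assumes "prec v a" and "prec v b"
  shows "prec v (\<lambda>e. of_bool (a e \<le> b e))"
proof -
  have *: "of_bool (x \<le> y) = 1 - (x - y)" for x y :: nat
    by simp
  show ?thesis
    unfolding * by (rule assms prec_imp_uniform_length[OF assms(1)] prec_intros)+
qed

lemma prec_of_bool_less [prec_intros]:
  assumes "prec v a" and "prec v b"
  shows "prec v (\<lambda>e. of_bool (a e < b e))"
  unfolding less_eq_Suc_le by (rule assms prec_intros)+

lemma prec_of_bool_conj [prec_intros]:
  assumes "prec v (\<lambda>e. of_bool (P e))" and "prec v (\<lambda>e. of_bool (Q e))"
  shows "prec v (\<lambda>e. of_bool (P e \<and> Q e))"
  unfolding of_bool_conj by (rule assms prec_intros)+

lemma prec_of_bool_eq [prec_intros]: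
  assumes "prec v a" and "prec v b"
  shows "prec v (\<lambda>e. of_bool (a e = b e))"
  unfolding order_eq_iff[of "a _"] by (rule assms prec_intros)+

lemma prec_of_bool_bex [prec_intros]:
  assumes "prec v n" and "prec (\<lambda>p. fst p # v (snd p)) (\<lambda>p. of_bool (P (fst p) (snd p)))"
  shows "prec v (\<lambda>e. of_bool (\<exists>i<n e. P i e))"
proof -
  have *: "(\<exists>i<k. Q i) \<longleftrightarrow> 0 < (\<Sum>i<k. of_bool (Q i) :: nat)" for k and Q :: "nat \<Rightarrow> bool"
    by (auto simp: zero_less_iff_neq_zero)
  show ?thesis
    unfolding * by (rule assms prec_imp_uniform_length[OF assms(1)] prec_intros)+
qed

lemma prec_If [prec_intros]:
  assumes "prec v (\<lambda>e. of_bool (P e))" and "prec v a" and "prec v b"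
  shows "prec v (\<lambda>e. if P e then a e else b e)"
proof -
  have *: "(if Q then x else y) = of_bool Q * x + (1 - of_bool Q) * y" for Q and x y :: nat
    by simp
  show ?thesis
    unfolding * by (rule assms prec_imp_uniform_length[OF assms(2)] prec_intros)+
qed

lemma prec_div [prec_intros]:
  assumes "prec v a" and "prec v b"
  shows "prec v (\<lambda>e. a e div b e)"
proof -
  note [prec_intros] = assms[THEN prec_reindex]
    assms(1)[THEN prec_imp_uniform_length, THEN uniform_length_reindex]
  \<comment> \<open>The quotient counts the \<open>i\<close> with \<open>Suc i * y \<le> x\<close>,
    all of which lie below \<open>x\<close>. The case \<open>y = 0\<close> is split off because
    \<open>x div 0 = 0\<close>, while the count would be \<open>x\<close>.\<close>
  have *: "x div y = (if y = 0 then 0 else \<Sum>i<x. of_bool (Suc i * y \<le> x))" for x y :: nat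
  proof (cases "y = 0")
    case False
    then have "i < x div y \<longleftrightarrow> Suc i * y \<le> x" for i
      by (simp only: less_eq_Suc_le less_eq_div_iff_mult_less_eq)
    moreover have "i < x" if "i < x div y" for i
      using that div_le_dividend[of x y] by linarith
    ultimately have "{i \<in> {..<x}. Suc i * y \<le> x} = {..<x div y}"
      by auto
    with False show ?thesis
      by (simp flip: sum.inter_filter add: of_bool_def)
  qed simp
  show ?thesis
    unfolding * by (rule prec_var_hd prec_intros | rule prec_var_tl)+
qed

lemma prec_mod [prec_intros]:
  assumes "prec v a" and "prec v b"
  shows "prec v (\<lambda>e. a e mod b e)"
  unfolding modulo_nat_def by (rule assms prec_intros)+

lemma prec_of_bool_odd [prec_intros]:
  assumes "prec v a"
  shows "prec v (\<lambda>e. of_bool (odd (a e)))"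
  unfolding odd_iff_mod_2_eq_one by (rule assms prec_imp_uniform_length[OF assms(1)] prec_intros)+

section \<open>Codes of pairs, lists and tables\<close>

lemma prec_prod_encode [prec_intros]:
  assumes "prec v a" and "prec v b"
  shows "prec v (\<lambda>e. prod_encode (a e, b e))"
  unfolding prod_encode_def triangle_def prod.case
  by (rule assms prec_imp_uniform_length[OF assms(1)] prec_intros)+

text \<open>Both components of a pair are bounded by its code, and exactly one pair has code
  \<open>c\<close>. The double sum therefore has at most one nonzero summand, and decoding reduces
  to bounded sums over the graph of \<open>prod_encode\<close>.\<close>

lemma prod_decode_as_sum:
  "fst (prod_decode c) = (\<Sum>a<Suc c. \<Sum>b<Suc c. of_bool (prod_encode (a, b) = c) * a)"
  "snd (prod_decode c) = (\<Sum>a<Suc c. \<Sum>b<Suc c. of_bool (prod_encode (a, b) = c) * b)"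
proof -
  obtain x y where xy: "prod_decode c = (x, y)"
    by fastforce
  then have c: "c = prod_encode (x, y)"
    by (metis prod_decode_inverse)
  have le: "x \<le> c" "y \<le> c"
    by (auto simp: c le_prod_encode_1 le_prod_encode_2)
  have eq: "prod_encode (a, b) = c \<longleftrightarrow> a = x \<and> b = y" for a b
    by (auto simp: c prod_encode_eq)
  have "(\<Sum>a<Suc c. \<Sum>b<Suc c. of_bool (prod_encode (a, b) = c) * f a b) = f x y" for f :: "nat \<Rightarrow> nat \<Rightarrow> nat"
  proof -
    have "(\<Sum>a<Suc c. \<Sum>b<Suc c. of_bool (prod_encode (a, b) = c) * f a b) =
        (\<Sum>a<Suc c. if a = x then (\<Sum>b<Suc c. if b = y then f x y else 0) else 0)"
      unfolding eq by (intro sum.cong refl) (auto intro!: sum.cong)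
    also have "\<dots> = f x y"
      using le by (simp del: sum.lessThan_Suc)
    finally show ?thesis .
  qed
  from this[of "\<lambda>a b. a"] this[of "\<lambda>a b. b"]
  show "fst (prod_decode c) = (\<Sum>a<Suc c. \<Sum>b<Suc c. of_bool (prod_encode (a, b) = c) * a)"
    "snd (prod_decode c) = (\<Sum>a<Suc c. \<Sum>b<Suc c. of_bool (prod_encode (a, b) = c) * b)"
    by (simp_all only: xy fst_conv snd_conv)
qed

lemma prec_fst_prod_decode [prec_intros]:
  assumes "prec v a"
  shows "prec v (\<lambda>e. fst (prod_decode (a e)))"
proof -
  note [prec_intros] = assms[THEN prec_reindex] assms[THEN prec_imp_uniform_length, THEN uniform_length_reindex]
  show ?thesis
    unfolding prod_decode_as_sum by (rule prec_var_hd prec_intros | rule prec_var_tl)+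
qed

lemma prec_snd_prod_decode [prec_intros]:
  assumes "prec v a"
  shows "prec v (\<lambda>e. snd (prod_decode (a e)))"
proof -
  note [prec_intros] = assms[THEN prec_reindex] assms[THEN prec_imp_uniform_length, THEN uniform_length_reindex]
  show ?thesis
    unfolding prod_decode_as_sum by (rule prec_var_hd prec_intros | rule prec_var_tl)+
qed

text \<open>The code of a nonempty list is the successor of the code of the pair of its head and the
  code of its tail, so one round removes the first entry.\<close>

definition code_drop :: "nat \<Rightarrow> nat \<Rightarrow> nat" where
  "code_drop i c = ((\<lambda>c. snd (prod_decode (c - 1))) ^^ i) c"

definition code_nth :: "nat \<Rightarrow> nat \<Rightarrow> nat" where
  "code_nth c i = fst (prod_decode (code_drop i c - 1))"

lemma code_drop_list_encode: "code_drop i (list_encode xs) = list_encode (drop i xs)"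
proof (induction i)
  case (Suc i)
  \<comment> \<open>Past the end: the empty list has code 0, and \<open>0 - 1 = 0\<close> decodes to
    \<open>(0, 0)\<close>, so 0 is a fixed point of taking tails.\<close>
  have "prod_decode 0 = (0, 0)"
    by (simp add: prod_decode_def prod_decode_aux.simps[of 0 0])
  then have "snd (prod_decode (list_encode ys - 1)) = list_encode (tl ys)" for ys
    by (cases ys) simp_all
  with Suc show ?case
    by (simp add: code_drop_def tl_drop drop_Suc)
qed (simp add: code_drop_def)

lemma code_nth_list_encode: "i < length xs \<Longrightarrow> code_nth (list_encode xs) i = xs ! i"
  by (simp add: code_nth_def code_drop_list_encode flip: Cons_nth_drop_Suc)

lemma prec_code_drop [prec_intros]:
  assumes "prec v a" and "prec v b"
  shows "prec v (\<lambda>e. code_drop (a e) (b e))"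
proof -
  note [prec_intros] = assms[THEN prec_reindex]
    assms(1)[THEN prec_imp_uniform_length, THEN uniform_length_reindex]
  show ?thesis
    unfolding code_drop_def by (rule prec_var_hd prec_intros | rule prec_var_tl)+
qed

lemma prec_code_nth [prec_intros]:
  assumes "prec v a" and "prec v b"
  shows "prec v (\<lambda>e. code_nth (a e) (b e))"
  unfolding code_nth_def by (rule assms prec_imp_uniform_length[OF assms(1)] prec_intros)+

lemma prec_list_encode_Nil [prec_intros]:
  "uniform_length v \<Longrightarrow> prec v (\<lambda>e. list_encode [])"
  by (simp add: prec_const)

lemma prec_list_encode_Cons [prec_intros]:
  assumes "prec v a" and "prec v (\<lambda>e. list_encode (b e))"
  shows "prec v (\<lambda>e. list_encode (a e # b e))"
  unfolding list_encode.simps by (rule assms prec_intros)+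

lemma prec_list_encode_map [prec_intros]:
  assumes n: "prec v n" and g: "prec (\<lambda>p. fst p # v (snd p)) (\<lambda>p. g (fst p) (snd p))"
  shows "prec v (\<lambda>e. list_encode (map (\<lambda>i. g i e) [0..<n e]))"
proof -
  note intros = n[THEN prec_reindex] n[THEN prec_imp_uniform_length, THEN uniform_length_reindex]
    prec_var_hd prec_intros
  \<comment> \<open>A list code is built from the back: round \<open>i\<close> prepends the entry
    with index \<open>k - Suc i\<close>, and after \<open>j\<close> rounds the last \<open>j\<close>
    entries are coded.\<close>
  have "list_encode (map f [k - j..<k]) =
      rec_nat 0 (\<lambda>i z. Suc (prod_encode (f (k - Suc i), z))) j" if "j \<le> k" for f :: "nat \<Rightarrow> nat" and j k
    using that
  proof (induction j)
    case (Suc j)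
    then have "[k - Suc j..<k] = (k - Suc j) # [k - j..<k]"
      by (simp add: upt_conv_Cons Suc_diff_Suc)
    with Suc show ?case
      by simp
  qed simp
  from this[OF order_refl]
  have *: "list_encode (map f [0..<k]) = rec_nat 0 (\<lambda>i z. Suc (prod_encode (f (k - Suc i), z))) k"
    for f :: "nat \<Rightarrow> nat" and k
    by simp
  have body: "prec (\<lambda>p. fst p # fst (snd p) # v (snd (snd p))) (\<lambda>p. g (n (snd (snd p)) - Suc (fst p)) (snd (snd p)))"
  proof (rule prec_subst[OF g, where u = "\<lambda>p. [fst p, fst (snd p)]"])
    show "prec (\<lambda>p. fst p # fst (snd p) # v (snd (snd p))) (\<lambda>p. n (snd (snd p)) - Suc (fst p))"
      by (rule intros | rule prec_var_tl)+
  qed (auto intro!: intros)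
  show ?thesis
    unfolding * by (rule body intros | rule prec_var_tl)+
qed

lemma prec_table_code [prec_intros]:
  assumes "prec v m" and "prec v n"
    and f: "prec (\<lambda>p. fst p # fst (snd p) # v (snd (snd p))) (\<lambda>p. f (fst (snd p)) (fst p) (snd (snd p)))"
  shows "prec v (\<lambda>e. table_code (m e) (n e) (\<lambda>i j. f i j e))"
  unfolding table_code_def
  by (rule assms assms(2)[THEN prec_reindex] prec_intros | rule prec_var_tl)+

section \<open>Binary codes of sets\<close>

text \<open>The full set \<open>{..<n}\<close> has code \<open>2 ^ n - 1\<close>, which bounds the
  codes of its subsets; conversely a member \<open>i\<close> forces \<open>2 ^ i \<le> s\<close>.
  The bound makes sets of states range over an initial segment.\<close>

lemma set_decode_subset_lessThan_iff: "set_decode s \<subseteq> {..<n} \<longleftrightarrow> s < 2 ^ n"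
proof
  assume "set_decode s \<subseteq> {..<n}"
  then have "set_encode (set_decode s) \<le> (\<Sum>i<n. 2 ^ i)"
    unfolding set_encode_def by (intro sum_mono2) auto
  also have "\<dots> < 2 ^ n"
    by (induction n) auto
  finally show "s < 2 ^ n"
    by simp
next
  assume s: "s < 2 ^ n"
  show "set_decode s \<subseteq> {..<n}"
  proof
    fix i assume "i \<in> set_decode s"
    then have "s div 2 ^ i \<noteq> 0"
      by (auto simp: set_decode_def intro: Nat.gr0I)
    then have "(2::nat) ^ i \<le> s"
      by (simp add: div_eq_0_iff)
    with s have "(2::nat) ^ i < 2 ^ n"
      by (rule le_less_trans[rotated])
    then show "i \<in> {..<n}"
      by simp
  qed
qed

text \<open>Insertion on set codes. The bit is tested first, since adding \<open>2 ^ q\<close> to a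
  set bit would carry.\<close>

definition add_bit :: "nat \<Rightarrow> nat \<Rightarrow> nat" where
  "add_bit s q = (if odd (s div 2 ^ q) then s else s + 2 ^ q)"

lemma set_decode_add_bit: "set_decode (add_bit s q) = insert q (set_decode s)"
proof (cases "q \<in> set_decode s")
  case True
  then show ?thesis
    by (auto simp: add_bit_def set_decode_def)
next
  case False
  then show ?thesis
    using set_decode_plus_power_2[OF False] by (simp add: add_bit_def set_decode_def add.commute)
qed

section \<open>Transformation monoids on numerals\<close>

text \<open>A map on \<open>{..<N}\<close> is coded by the numeral in base \<open>N\<close> whose digits are its values.\<close>

definition digit :: "nat \<Rightarrow> nat \<Rightarrow> nat \<Rightarrow> nat" where
  "digit N f x = f div N ^ x mod N"

definition tabulate :: "nat \<Rightarrow> (nat \<Rightarrow> nat) \<Rightarrow> nat" where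
  "tabulate N g = (\<Sum>x<N. g x * N ^ x)"

lemma digit_less: "0 < N \<Longrightarrow> digit N f x < N"
  by (simp add: digit_def)

lemma sum_digits_less:
  fixes N :: nat
  assumes "\<And>i. i < k \<Longrightarrow> g i < N"
  shows "(\<Sum>i<k. g i * N ^ i) < N ^ k"
  using assms
proof (induction k)
  case (Suc k)
  then have "(\<Sum>i<k. g i * N ^ i) < N ^ k" and "Suc (g k) \<le> N"
    by (simp_all add: Suc_leI)
  moreover from this(2) have "Suc (g k) * N ^ k \<le> N * N ^ k"
    by (rule mult_le_mono1)
  ultimately show ?case
    by simp
qed simp

lemma digit_sum_digits:
  assumes "\<And>i. i < k \<Longrightarrow> g i < N" and "x < k"
  shows "digit N (\<Sum>i<k. g i * N ^ i) x = g x"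
  using assms
proof (induction k)
  case (Suc k)
  then have less: "(\<Sum>i<k. g i * N ^ i) < N ^ k"
    by (intro sum_digits_less) simp
  have N: "0 < N"
    using Suc.prems(1)[of k] by simp
  show ?case
  proof (cases "x = k")
    case True
    with less N Suc.prems(1)[of k] show ?thesis
      by (simp add: digit_def)
  next
    case False
    with Suc.prems have "x < k"
      by simp
    then obtain j where j: "k = Suc (x + j)"
      by (auto dest: less_imp_Suc_add)
    \<comment> \<open>The top summand is a multiple of \<open>N * N ^ x\<close>. Division by
      \<open>N ^ x\<close> leaves a multiple of \<open>N\<close>, which \<open>mod N\<close>
      removes.\<close>
    have "(\<Sum>i<Suc k. g i * N ^ i) = (\<Sum>i<k. g i * N ^ i) + g k * N ^ j * N * N ^ x"
      by (simp add: j power_add)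
    then have "(\<Sum>i<Suc k. g i * N ^ i) div N ^ x = g k * N ^ j * N + (\<Sum>i<k. g i * N ^ i) div N ^ x"
      using N by (simp only: div_mult_self1) simp
    with Suc \<open>x < k\<close> show ?thesis
      by (simp add: digit_def)
  qed
qed simp

lemma digit_tabulate: "(\<And>i. i < N \<Longrightarrow> g i < N) \<Longrightarrow> x < N \<Longrightarrow> digit N (tabulate N g) x = g x"
  unfolding tabulate_def by (rule digit_sum_digits)

lemma tabulate_less: "(\<And>i. i < N \<Longrightarrow> g i < N) \<Longrightarrow> tabulate N g < N ^ N"
  unfolding tabulate_def by (rule sum_digits_less)

lemma tabulate_cong: "(\<And>x. x < N \<Longrightarrow> g x = g' x) \<Longrightarrow> tabulate N g = tabulate N g'"
  by (simp add: tabulate_def)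

text \<open>Truncating the expansion after \<open>k\<close> digits gives \<open>f mod N ^ k\<close>.
  Codes below \<open>N ^ N\<close> are thus canonical, which makes the unit laws equalities of
  numbers.\<close>

lemma tabulate_digit:
  assumes "f < N ^ N"
  shows "tabulate N (digit N f) = f"
proof -
  have "(\<Sum>i<k. digit N f i * N ^ i) = f mod N ^ k" for k
    by (induction k) (simp_all add: digit_def mod_mult2_eq power_Suc2 del: power_Suc)
  with assms show ?thesis
    by (simp add: tabulate_def)
qed

text \<open>The left factor acts first, so that products follow the reading direction of words. The
  carrier is an initial segment, as the presentation of a monoid to the oracle demands.\<close>

definition transformation_monoid :: "nat \<Rightarrow> nat monoid" where
  "transformation_monoid N =
     \<lparr>carrier = {..<N ^ N}, mult = (\<lambda>f g. tabulate N (\<lambda>x. digit N g (digit N f x))),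
      one = tabulate N (\<lambda>x. x)\<rparr>"

lemma monoid_transformation_monoid:
  assumes "0 < N"
  shows "monoid (transformation_monoid N)"
proof (rule monoidI)
  fix f g h
  show "f \<otimes>\<^bsub>transformation_monoid N\<^esub> g \<in> carrier (transformation_monoid N)"
    using assms by (simp add: transformation_monoid_def tabulate_less digit_less)
  show "f \<otimes>\<^bsub>transformation_monoid N\<^esub> g \<otimes>\<^bsub>transformation_monoid N\<^esub> h =
      f \<otimes>\<^bsub>transformation_monoid N\<^esub> (g \<otimes>\<^bsub>transformation_monoid N\<^esub> h)"
    using assms by (auto simp: transformation_monoid_def digit_tabulate digit_less intro: tabulate_cong)
next
  show "\<one>\<^bsub>transformation_monoid N\<^esub> \<in> carrier (transformation_monoid N)"
    by (simp add: transformation_monoid_def tabulate_less)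
next
  fix f assume f: "f \<in> carrier (transformation_monoid N)"
  have "tabulate N (\<lambda>x. digit N f (digit N (tabulate N (\<lambda>x. x)) x)) = tabulate N (digit N f)"
    by (rule tabulate_cong) (simp add: digit_tabulate)
  with f show "\<one>\<^bsub>transformation_monoid N\<^esub> \<otimes>\<^bsub>transformation_monoid N\<^esub> f = f"
    by (simp add: transformation_monoid_def tabulate_digit)
  have "tabulate N (\<lambda>x. digit N (tabulate N (\<lambda>x. x)) (digit N f x)) = tabulate N (digit N f)"
    using assms by (intro tabulate_cong) (simp add: digit_tabulate digit_less)
  with f show "f \<otimes>\<^bsub>transformation_monoid N\<^esub> \<one>\<^bsub>transformation_monoid N\<^esub> = f"
    by (simp add: transformation_monoid_def tabulate_digit)
qed

definition action_morphism :: "nat \<Rightarrow> (nat \<Rightarrow> 'a \<Rightarrow> nat) \<Rightarrow> 'a list \<Rightarrow> nat" where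
  "action_morphism N act w = tabulate N (\<lambda>x. fold (\<lambda>a x. act x a) w x)"

lemma fold_action_less:
  fixes N :: nat
  assumes "\<And>x a. x < N \<Longrightarrow> a \<in> \<Sigma> \<Longrightarrow> act x a < N"
  shows "w \<in> lists \<Sigma> \<Longrightarrow> x < N \<Longrightarrow> fold (\<lambda>a x. act x a) w x < N"
  by (induction w arbitrary: x) (simp_all add: assms)

lemma digit_action_morphism:
  assumes "\<And>x a. x < N \<Longrightarrow> a \<in> \<Sigma> \<Longrightarrow> act x a < N" and "w \<in> lists \<Sigma>" and "x < N"
  shows "digit N (action_morphism N act w) x = fold (\<lambda>a x. act x a) w x"
  unfolding action_morphism_def
  by (rule digit_tabulate) (use assms fold_action_less[where act = act and \<Sigma> = \<Sigma>] in auto)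

text \<open>Folding over \<open>u @ v\<close> means acting by \<open>u\<close> and then by
  \<open>v\<close>, which is the product in this order of composition.\<close>

lemma monoid_morphism_action_morphism:
  assumes "\<And>x a. x < N \<Longrightarrow> a \<in> \<Sigma> \<Longrightarrow> act x a < N"
  shows "monoid_morphism \<Sigma> (transformation_monoid N) (action_morphism N act)"
  unfolding monoid_morphism_def
proof (intro conjI homI)
  note less = fold_action_less[where act = act and \<Sigma> = \<Sigma>, OF assms]
  fix u v assume u: "u \<in> carrier (free_monoid \<Sigma>)" and v: "v \<in> carrier (free_monoid \<Sigma>)"
  then show "action_morphism N act u \<in> carrier (transformation_monoid N)"
    using less by (simp add: free_monoid_def transformation_monoid_def action_morphism_def tabulate_less)
  show "action_morphism N act (u \<otimes>\<^bsub>free_monoid \<Sigma>\<^esub> v) =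
      action_morphism N act u \<otimes>\<^bsub>transformation_monoid N\<^esub> action_morphism N act v"
    using u v less digit_action_morphism[where act = act and \<Sigma> = \<Sigma>, OF assms]
    by (simp add: free_monoid_def transformation_monoid_def action_morphism_def[of _ _ "u @ v"]
        cong: tabulate_cong)
qed (simp add: transformation_monoid_def action_morphism_def)

section \<open>Infinite concatenations\<close>

definition concat_length :: "(nat \<Rightarrow> 'a list) \<Rightarrow> nat \<Rightarrow> nat" where
  "concat_length u n = length (concat (map u [0..<n]))"

lemma concat_upt_append:
  assumes "i \<le> j"
  shows "concat (map u [0..<j]) = concat (map u [0..<i]) @ concat (map u [i..<j])"
  using assms by (metis concat_append le_add_diff_inverse map_append upt_add_eq_append zero_le)

lemma concat_length_mono: "i \<le> j \<Longrightarrow> concat_length u i \<le> concat_length u j"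
  by (simp add: concat_length_def concat_upt_append)

lemma word_concat_unbounded:
  assumes "word_concat u = Some \<circ> \<gamma>"
  shows "\<exists>n. k < concat_length u n"
proof -
  have "word_concat u k \<noteq> None"
    using assms by simp
  then show ?thesis
    by (auto simp: word_concat_def concat_length_def split: if_splits)
qed

text \<open>The least index used by \<open>word_concat\<close> for position \<open>k\<close> is at
  most \<open>n\<close>, and the shorter concatenation is a prefix of the longer one, so both have
  the same letter at \<open>k\<close>.\<close>

lemma word_concat_prefix:
  assumes "word_concat u = Some \<circ> \<gamma>"
  shows "concat (map u [0..<n]) = map \<gamma> [0..<concat_length u n]"
proof (rule nth_equalityI)
  fix k assume k: "k < length (concat (map u [0..<n]))"
  define m where "m = (LEAST n. k < length (concat (map u [0..<n])))"
  have m: "k < length (concat (map u [0..<m]))" "m \<le> n"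
    unfolding m_def using k by (rule LeastI, rule Least_le)
  have "\<exists>n. k < length (concat (map u [0..<n]))"
    using k ..
  then have "word_concat u k = Some (concat (map u [0..<m]) ! k)"
    unfolding word_concat_def m_def by (rule if_P)
  with assms have "\<gamma> k = concat (map u [0..<m]) ! k"
    by simp
  with m have "\<gamma> k = concat (map u [0..<n]) ! k"
    by (simp add: concat_upt_append[OF m(2)] nth_append)
  with k show "concat (map u [0..<n]) ! k = map \<gamma> [0..<concat_length u n] ! k"
    by (simp add: concat_length_def)
qed (simp add: concat_length_def)

lemma word_concat_segment:
  assumes "word_concat u = Some \<circ> \<gamma>" and "i \<le> j"
  shows "concat (map u [i..<j]) = map \<gamma> [concat_length u i..<concat_length u j]"
proof -
  have "map \<gamma> [0..<concat_length u i] @ concat (map u [i..<j]) = map \<gamma> [0..<concat_length u j]"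
    using concat_upt_append[OF assms(2), of u] by (simp add: word_concat_prefix[OF assms(1)])
  also have "\<dots> = map \<gamma> [0..<concat_length u i] @ map \<gamma> [concat_length u i..<concat_length u j]"
    using upt_add_eq_append[of 0 "concat_length u i" "concat_length u j - concat_length u i"]
      concat_length_mono[OF assms(2), of u] by (simp flip: map_append)
  finally show ?thesis
    by simp
qed

text \<open>The blocks \<open>{p j<..p (Suc j)}\<close> cover all positions beyond
  \<open>p 0\<close>. A state seen infinitely often lies in infinitely many blocks, and as
  \<open>Y\<close> has finite range, one value \<open>y\<close> recurs among these. Conversely,
  every recurrence of \<open>y\<close> produces each element of \<open>S y\<close> again, at
  positions that grow beyond all bounds.\<close>

lemma limit_eq_Union_blocks:
  fixes p :: "nat \<Rightarrow> nat"
  assumes fin: "finite (range Y)" and mono: "mono p" and unbounded: "\<And>k. \<exists>j. k < p j"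
    and block: "\<And>j. S (Y (Suc j)) = \<rho> ` {p j<..p (Suc j)}"
  shows "limit \<rho> = (\<Union>y\<in>limit Y. S y)"
proof (intro equalityI subsetI)
  fix q assume "q \<in> limit \<rho>"
  then have inf: "\<forall>m. \<exists>i>m. \<rho> i = q"
    by (simp add: limit_def INFM_nat)
  have "\<exists>j>m. q \<in> S (Y j)" for m
  proof -
    obtain i where i: "i > p m" "\<rho> i = q"
      using inf by blast
    \<comment> \<open>The block containing \<open>i\<close> ends at \<open>p j\<close>; as
      \<open>i > p m\<close>, the index \<open>j\<close> exceeds \<open>m\<close> and is a
      successor.\<close>
    define j where "j = (LEAST j. i \<le> p j)"
    obtain j0 where "i \<le> p j0"
      using unbounded less_imp_le by blast
    then have ij: "i \<le> p j"
      unfolding j_def by (rule LeastI)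
    have "\<not> j \<le> m"
      using ij i monoD[OF mono, of j m] by auto
    then obtain j' where j': "j = Suc j'"
      by (cases j) auto
    then have "\<not> i \<le> p j'"
      using not_less_Least[of j' "\<lambda>j. i \<le> p j"] by (simp add: j_def)
    with ij i(2) have "q \<in> S (Y j)"
      by (auto simp: j' block)
    with \<open>\<not> j \<le> m\<close> show ?thesis
      by (auto simp: not_le)
  qed
  then have "\<exists>\<^sub>\<infinity>j. \<exists>y\<in>range Y. Y j = y \<and> q \<in> S y"
    by (auto simp: INFM_nat)
  then obtain y where "\<exists>\<^sub>\<infinity>j. Y j = y \<and> q \<in> S y"
    using frequently_bex_finite[OF fin, of "\<lambda>j y. Y j = y \<and> q \<in> S y"] by blast
  then show "q \<in> (\<Union>y\<in>limit Y. S y)"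
    by (auto simp: limit_def INFM_nat)
next
  fix q assume "q \<in> (\<Union>y\<in>limit Y. S y)"
  then obtain y where y: "\<forall>m. \<exists>j>m. Y j = y" "q \<in> S y"
    by (auto simp: limit_def INFM_nat)
  have "\<exists>i>m. \<rho> i = q" for m
  proof -
    obtain j0 where j0: "m < p j0"
      using unbounded by blast
    obtain j where "j > j0" "Y j = y"
      using y by blast
    moreover from this obtain j' where j': "j = Suc j'"
      by (cases j) auto
    ultimately obtain i where "q = \<rho> i" "p j' < i"
      using y(2) block[of j'] by auto
    moreover have "p j0 \<le> p j'"
      using \<open>j > j0\<close> by (intro monoD[OF mono]) (simp add: j')
    ultimately show ?thesis
      using j0 by (auto intro!: exI[of _ i])
  qed
  then show "q \<in> limit \<rho>"
    by (simp add: limit_def INFM_nat)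
qed

section \<open>Recording visited states\<close>

text \<open>The pair \<open>(q, S)\<close> is coded by \<open>q + n * set_encode S\<close>.\<close>

definition visit :: "nat \<Rightarrow> nat \<Rightarrow> nat \<Rightarrow> nat" where
  "visit n x q = q + n * add_bit (x div n) q"

text \<open>Used at both levels of the coding: for a state with a set of states, and for a
  transducer state with such a pair.\<close>

lemma pair_less:
  fixes n :: nat
  assumes "q < n" and "s < k"
  shows "q + n * s < n * k"
proof -
  have "q + n * s < n * Suc s"
    using assms(1) by simp
  also have "\<dots> \<le> n * k"
    using assms(2) by (intro mult_le_mono2) simp
  finally show ?thesis .
qed

lemma visit_less:
  assumes "x < n * 2 ^ n" and "q < n"
  shows "visit n x q < n * 2 ^ n"
  unfolding visit_def
proof (rule pair_less)
  have "x div n < 2 ^ n"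
    using assms(1) by (simp add: less_mult_imp_div_less mult.commute)
  then show "add_bit (x div n) q < 2 ^ n"
    using assms(2) by (simp add: set_decode_add_bit flip: set_decode_subset_lessThan_iff)
qed fact

definition muller_visit :: "(nat, 'a) muller \<Rightarrow> nat \<Rightarrow> nat \<Rightarrow> 'a \<Rightarrow> nat" where
  "muller_visit A n x a = visit n x (mtrans A (x mod n) a)"

lemma muller_visit_less:
  assumes "muller_automaton \<Sigma> A" and "mstates A = {..<n}" and "x < n * 2 ^ n" and "a \<in> \<Sigma>"
  shows "muller_visit A n x a < n * 2 ^ n"
  unfolding muller_visit_def using assms
  by (intro visit_less) (auto simp: muller_automaton_def)

lemma muller_run_in_states:
  assumes "muller_automaton \<Sigma> A" and "range \<alpha> \<subseteq> \<Sigma>"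
  shows "muller_run A \<alpha> i \<in> mstates A"
  using assms by (induction i) (auto simp: muller_automaton_def)

text \<open>A letter records the state it leads to and not the state it leaves, hence the interval
  \<open>{i<..j}\<close>. Consecutive factors then use disjoint blocks of positions, and an empty
  factor records nothing.\<close>

lemma fold_muller_visit:
  assumes A: "muller_automaton \<Sigma> A" "mstates A = {..<n}" and \<alpha>: "range \<alpha> \<subseteq> \<Sigma>"
    and "i \<le> j" and "x mod n = muller_run A \<alpha> i"
  defines "y \<equiv> fold (\<lambda>a x. muller_visit A n x a) (map \<alpha> [i..<j]) x"
  shows "y mod n = muller_run A \<alpha> j \<and>
    set_decode (y div n) = set_decode (x div n) \<union> muller_run A \<alpha> ` {i<..j}"
  unfolding y_def using assms(4)
proof (induction rule: dec_induct)
  case base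
  with assms(5) show ?case by simp
next
  case (step j)
  let ?y = "fold (\<lambda>a x. muller_visit A n x a) (map \<alpha> [i..<j]) x"
  have "muller_run A \<alpha> (Suc j) < n"
    using muller_run_in_states[OF A(1) \<alpha>, of "Suc j"] A(2) by simp
  moreover have "fold (\<lambda>a x. muller_visit A n x a) (map \<alpha> [i..<Suc j]) x =
      muller_run A \<alpha> (Suc j) + n * add_bit (?y div n) (muller_run A \<alpha> (Suc j))"
    using step by (simp add: muller_visit_def visit_def)
  moreover have "{i<..Suc j} = insert (Suc j) {i<..j}"
    using step by auto
  ultimately show ?case
    using step.IH by (simp add: set_decode_add_bit del: muller_run.simps)
qed

section \<open>The product automaton\<close>

text \<open>Here \<open>u\<close> codes a word emitted by the transducer; its letters are codes of
  transformations and act on \<open>x\<close> from left to right.\<close>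

definition eval_digits :: "nat \<Rightarrow> nat \<Rightarrow> nat \<Rightarrow> nat" where
  "eval_digits N u x = fold (digit N) (list_decode u) x"

text \<open>
  The state \<open>r\<close> of the transducer together with the pair coded by \<open>x\<close> is coded by \<open>r + R * x\<close>;
  taking \<open>y div R\<close> modulo \<open>n\<close> resets the set of visited states.
\<close>

definition product_step :: "nat \<Rightarrow> nat \<Rightarrow> nat \<Rightarrow> nat \<Rightarrow> nat \<Rightarrow> nat" where
  "product_step n R tab y b =
     fst (prod_decode (code_nth (code_nth tab (y mod R)) b)) +
     R * eval_digits (n * 2 ^ n) (snd (prod_decode (code_nth (code_nth tab (y mod R)) b))) (y div R mod n)"

definition visited :: "nat \<Rightarrow> nat \<Rightarrow> nat \<Rightarrow> nat set" where
  "visited n R y = set_decode (y div R div n)"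

text \<open>The acceptance condition is dictated by \<open>limit_eq_Union_blocks\<close>: the union
  of the recorded sets over the limit set of the product run is the limit set of the run of
  \<open>A\<close>. The initial state carries the empty set.\<close>

definition product_automaton :: "nat \<Rightarrow> (nat, nat) muller \<Rightarrow> nat \<Rightarrow> (nat, nat) muller" where
  "product_automaton n A t =
     (let R = code_nth t 0 in
      \<lparr>mstates = {..<R * (n * 2 ^ n)}, minit = code_nth t 1 + R * minit A,
       mtrans = product_step n R (code_nth t 2),
       macc = {F. F \<subseteq> {..<R * (n * 2 ^ n)} \<and> {j. j < n \<and> (\<exists>y\<in>F. j \<in> visited n R y)} \<in> macc A}\<rparr>)"

lemma table_code_nth:
  assumes "i < m" and "j < n"
  shows "code_nth (code_nth (table_code m n f) i) j = f i j"
  using assms by (simp add: table_code_def code_nth_list_encode)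

lemma transducer_code_nth:
  "code_nth (transducer_code k T) 0 = card (tstates T)"
  "code_nth (transducer_code k T) (Suc 0) = tinit T"
  "code_nth (transducer_code k T) 2 = table_code (card (tstates T)) k
     (\<lambda>r a. prod_encode (fst (tstep T r a), list_encode (snd (tstep T r a))))"
  by (simp_all add: transducer_code_def code_nth_list_encode del: list_encode.simps)

lemma muller_code_nth:
  "code_nth (muller_code k A) 0 = card (mstates A)"
  "code_nth (muller_code k A) (Suc 0) = minit A"
  "code_nth (muller_code k A) 2 = table_code (card (mstates A)) k (mtrans A)"
  "code_nth (muller_code k A) 3 = set_encode (set_encode ` macc A)"
  by (simp_all add: muller_code_def code_nth_list_encode del: list_encode.simps)

lemma fold_digit_less: "0 < N \<Longrightarrow> x < N \<Longrightarrow> fold (digit N) fs x < N"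
  by (induction fs arbitrary: x) (simp_all add: digit_less)

text \<open>The image of a word acts on points below \<open>N\<close> as the word does, and the
  action keeps points below \<open>N\<close>, so the images can be applied one after
  another.\<close>

lemma fold_digit_action_morphism:
  assumes act: "\<And>x a. x < N \<Longrightarrow> a \<in> \<Sigma> \<Longrightarrow> act x a < N"
    and ws: "\<And>w. w \<in> set ws \<Longrightarrow> w \<in> lists \<Sigma>" and "x < N"
  shows "fold (digit N) (map (action_morphism N act) ws) x = fold (\<lambda>a x. act x a) (concat ws) x"
  using ws \<open>x < N\<close>
proof (induction ws arbitrary: x)
  case (Cons w ws)
  have "fold (\<lambda>a x. act x a) w x < N"
    using Cons.prems fold_action_less[where act = act and \<Sigma> = \<Sigma>, OF act] by auto
  with Cons show ?case
    using digit_action_morphism[where act = act and \<Sigma> = \<Sigma>, OF act] by simp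
qed simp

text \<open>The invariant is that after \<open>j\<close> letters of \<beta> the product holds the
  transducer state and the state of \<open>A\<close> at the position of \<alpha> where the factors
  consumed so far end.\<close>

lemma product_automaton_correct:
  assumes A: "muller_automaton {..<k1} A" "mstates A = {..<n}"
    and T: "finite_transducer {..<k2} \<Gamma> T" "tstates T = {..<R}"
    and \<alpha>: "range \<alpha> \<subseteq> {..<k1}" and \<beta>: "range \<beta> \<subseteq> {..<k2}"
    and w: "\<And>i. w i \<in> lists {..<k1}" "word_concat w = Some \<circ> \<alpha>"
    and out: "transducer_output T \<beta> =
      Some \<circ> (\<lambda>i. action_morphism (n * 2 ^ n) (muller_visit A n) (w i))"
  defines "B \<equiv> product_automaton n A (transducer_code k2 T)"
  shows "muller_automaton {..<k2} B" and "\<alpha> \<in> muller_lang {..<k1} A \<longleftrightarrow> \<beta> \<in> muller_lang {..<k2} B"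
proof -
  let ?N = "n * 2 ^ n"
  have init: "minit A < n" "tinit T < R"
    using A T by (auto simp: muller_automaton_def finite_transducer_def)
  then have N: "0 < ?N"
    by simp
  have B: "mstates B = {..<R * ?N}" "minit B = tinit T + R * minit A"
    "mtrans B = product_step n R (code_nth (transducer_code k2 T) 2)"
    "macc B = {F. F \<subseteq> {..<R * ?N} \<and> {j. j < n \<and> (\<exists>y\<in>F. j \<in> visited n R y)} \<in> macc A}"
    using T by (simp_all add: B_def product_automaton_def transducer_code_nth)
  have n_le: "n \<le> ?N"
    by simp
  have mtrans_B: "mtrans B y b = fst (tstep T (y mod R) b) +
      R * fold (digit ?N) (snd (tstep T (y mod R) b)) (y div R mod n)" if "b < k2" for y b
    using that init T by (simp add: B transducer_code_nth product_step_def table_code_nth eval_digits_def)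
  have step_T: "fst (tstep T r b) < R" if "r < R" "b < k2" for r b
    using that T by (force simp: finite_transducer_def mem_Times_iff)
  show B_aut: "muller_automaton {..<k2} B"
    unfolding muller_automaton_def
  proof (intro conjI ballI)
    show "minit B \<in> mstates B"
      using pair_less[OF init(2) less_le_trans[OF init(1) n_le]] by (simp add: B)
    show "mtrans B y b \<in> mstates B" if "b \<in> {..<k2}" for y b
    proof -
      have "fold (digit ?N) (snd (tstep T (y mod R) b)) (y div R mod n) < ?N"
        using init n_le by (intro fold_digit_less N less_le_trans[OF mod_less_divisor]) auto
      moreover have "fst (tstep T (y mod R) b) < R"
        using that init by (intro step_T) auto
      ultimately have "mtrans B y b < R * ?N"
        using that by (simp only: mtrans_B lessThan_iff pair_less)
      then show ?thesis by (simp add: B)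
    qed
  qed (auto simp: B)

  \<comment> \<open>In step \<open>j\<close> the transducer emits \<open>em j\<close>. Before it,
    \<open>l j\<close> monoid elements have been emitted, and the factors they stand for make up the
    first \<open>p j\<close> letters of \<alpha>.\<close>
  define r where "r = transducer_run T \<beta>"
  define em where "em = (\<lambda>j. snd (tstep T (r j) (\<beta> j)))"
  define l where "l = concat_length em"
  define p where "p j = concat_length w (l j)" for j
  define h where "h = action_morphism ?N (muller_visit A n)"
  let ?\<rho> = "muller_run A \<alpha>" and ?Y = "muller_run B \<beta>"
  have \<beta>_less: "\<beta> j < k2" for j
    using \<beta> by auto
  have out': "word_concat em = Some \<circ> (\<lambda>i. h (w i))"
    using out by (simp add: transducer_output_def em_def r_def h_def)
  have r_less: "r j < R" for j
    unfolding r_def by (induction j) (simp_all add: init step_T \<beta>_less)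
  have l_mono: "l i \<le> l j" if "i \<le> j" for i j
    unfolding l_def using that by (rule concat_length_mono)
  have p_mono: "p i \<le> p j" if "i \<le> j" for i j
    unfolding p_def using l_mono[OF that] by (rule concat_length_mono)
  have em_eq: "em j = map h (map w [l j..<l (Suc j)])" for j
    using word_concat_segment[OF out', of j "Suc j"] by (simp add: l_def)
  have w_eq: "concat (map w [l j..<l (Suc j)]) = map \<alpha> [p j..<p (Suc j)]" for j
    unfolding p_def by (rule word_concat_segment[OF w(2)]) (simp add: l_mono)
  have eval_em: "fold (digit ?N) (em j) x = fold (\<lambda>a x. muller_visit A n x a) (map \<alpha> [p j..<p (Suc j)]) x"
    if "x < ?N" for j x
  proof -
    have "fold (digit ?N) (em j) x =
        fold (\<lambda>a x. muller_visit A n x a) (concat (map w [l j..<l (Suc j)])) x"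
      unfolding em_eq h_def
      by (rule fold_digit_action_morphism[where \<Sigma> = "{..<k1}"])
        (use that w(1) muller_visit_less[OF A] in auto)
    then show ?thesis
      by (simp only: w_eq)
  qed
  \<comment> \<open>The hypothesis says nothing about the recorded set, since a step begins by
    discarding it. Hence the block equation is available for successor indices.\<close>
  have step: "?Y (Suc j) mod R = r (Suc j) \<and> ?Y (Suc j) div R mod n = ?\<rho> (p (Suc j)) \<and>
      visited n R (?Y (Suc j)) = ?\<rho> ` {p j<..p (Suc j)}"
    if Y: "?Y j mod R = r j \<and> ?Y j div R mod n = ?\<rho> (p j)" for j
  proof -
    define z where "z = fold (\<lambda>a x. muller_visit A n x a) (map \<alpha> [p j..<p (Suc j)]) (?\<rho> (p j))"
    have \<rho>: "?\<rho> (p j) < n"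
      using muller_run_in_states[OF A(1) \<alpha>] A(2) by auto
    then have "?\<rho> (p j) < ?N"
      using n_le by (rule less_le_trans)
    have "?Y (Suc j) = fst (tstep T (r j) (\<beta> j)) + R * fold (digit ?N) (em j) (?\<rho> (p j))"
      using Y by (simp add: mtrans_B \<beta>_less em_def)
    also have "\<dots> = r (Suc j) + R * z"
      using \<open>?\<rho> (p j) < ?N\<close> by (simp only: eval_em z_def) (simp add: r_def)
    finally have "?Y (Suc j) = r (Suc j) + R * z" .
    \<comment> \<open>A number below \<open>n\<close> codes a pair with the empty set, so only the
      states of the current block are recorded.\<close>
    moreover have "z mod n = ?\<rho> (p (Suc j)) \<and> set_decode (z div n) = ?\<rho> ` {p j<..p (Suc j)}"
      using fold_muller_visit[OF A \<alpha>, of "p j" "p (Suc j)" "?\<rho> (p j)"] \<rho> p_mono[of j "Suc j"]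
      by (simp add: z_def)
    ultimately show ?thesis
      using r_less[of "Suc j"] by (simp add: visited_def)
  qed
  have inv: "?Y j mod R = r j \<and> ?Y j div R mod n = ?\<rho> (p j)" for j
  proof (induction j)
    case 0
    then show ?case
      using init by (simp add: B r_def p_def l_def concat_length_def)
  next
    case (Suc j)
    then show ?case
      using step by blast
  qed
  have block: "visited n R (?Y (Suc j)) = ?\<rho> ` {p j<..p (Suc j)}" for j
    using step[OF inv] by blast
  have Y_states: "range ?Y \<subseteq> {..<R * ?N}"
    using muller_run_in_states[OF B_aut \<beta>] by (auto simp: B)
  have limit_\<rho>: "limit ?\<rho> = (\<Union>y\<in>limit ?Y. visited n R y)"
  proof (rule limit_eq_Union_blocks[where p = p and Y = ?Y and S = "visited n R" and \<rho> = ?\<rho>, OF _ _ _ block])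
    show "finite (range ?Y)"
      using Y_states by (rule finite_subset) simp
    show "mono p"
      using p_mono by (rule monoI)
    \<comment> \<open>Single steps may emit nothing and factors may be empty, but both
      concatenations are infinite: finitely many factors reach beyond \<open>k\<close>, and the
      transducer eventually emits an element for each of them.\<close>
    show "\<exists>j. k < p j" for k
    proof -
      obtain i where i: "k < concat_length w i"
        using word_concat_unbounded[OF w(2)] ..
      obtain j where "i < l j"
        using word_concat_unbounded[OF out'] unfolding l_def ..
      then have "concat_length w i \<le> p j"
        unfolding p_def by (intro concat_length_mono) simp
      with i show ?thesis
        by (auto intro: less_le_trans)
    qed
  qed
  have "limit ?\<rho> \<subseteq> {..<n}"
    using limit_in_range[of ?\<rho>] muller_run_in_states[OF A(1) \<alpha>] A(2) by auto
  with limit_\<rho> have "{j. j < n \<and> (\<exists>y\<in>limit ?Y. j \<in> visited n R y)} = limit ?\<rho>"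
    by auto
  moreover have "limit ?Y \<subseteq> {..<R * ?N}"
    using limit_in_range[of ?Y] Y_states by blast
  ultimately show "\<alpha> \<in> muller_lang {..<k1} A \<longleftrightarrow> \<beta> \<in> muller_lang {..<k2} B"
    using \<alpha> \<beta> by (simp add: muller_lang_def B)
qed

section \<open>The algorithm\<close>

text \<open>The oracle query as an arithmetic function of the code \<open>a\<close> of the
  automaton; its entries are laid out as in \<open>morphism_code\<close>.\<close>

definition transition_code :: "nat \<Rightarrow> nat \<Rightarrow> nat" where
  "transition_code k a =
     (let n = code_nth a 0; N = n * 2 ^ n in
      list_encode
        [N ^ N, table_code (N ^ N) (N ^ N) (\<lambda>f g. tabulate N (\<lambda>x. digit N g (digit N f x))),
         tabulate N (\<lambda>x. x),
         list_encode
           (map (\<lambda>c. tabulate N (\<lambda>x. visit n x (code_nth (code_nth (code_nth a 2) (x mod n)) c))) [0..<k])])"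

text \<open>The image of a letter tabulates its action on all points; \<open>0 < n\<close> makes
  \<open>x mod n\<close> a valid row of the transition table.\<close>

lemma transition_code_muller_code:
  assumes "mstates A = {..<n}" and "0 < n"
  shows "transition_code k (muller_code k A) =
    morphism_code k (transformation_monoid (n * 2 ^ n)) (action_morphism (n * 2 ^ n) (muller_visit A n))"
proof -
  have "map (\<lambda>c. tabulate (n * 2 ^ n) (\<lambda>x. visit n x
          (code_nth (code_nth (code_nth (muller_code k A) 2) (x mod n)) c))) [0..<k] =
      map (\<lambda>a. action_morphism (n * 2 ^ n) (muller_visit A n) [a]) [0..<k]"
    using assms by (auto simp: action_morphism_def muller_visit_def muller_code_nth table_code_nth)
  with assms(1) show ?thesis
    by (simp add: transition_code_def morphism_code_def transformation_monoid_def muller_code_nth(1) Let_def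
        del: list_encode.simps map_eq_conv)
qed

text \<open>The last entry tries every \<open>c\<close> as the code of a set of product states. The
  inner sum is the code of the union of the recorded sets, and its membership in the acceptance
  family of \<open>A\<close> is a bit of \<open>code_nth a 3\<close>.\<close>

definition product_code :: "nat \<Rightarrow> nat \<Rightarrow> nat \<Rightarrow> nat" where
  "product_code k a t =
     (let n = code_nth a 0; N = n * 2 ^ n; R = code_nth t 0 in
      list_encode
        [R * N, code_nth t 1 + R * code_nth a 1,
         table_code (R * N) k (\<lambda>y b. product_step n R (code_nth t 2) y b),
         \<Sum>c<2 ^ (R * N). of_bool (odd (code_nth a 3 div
             2 ^ (\<Sum>j<n. of_bool (\<exists>y<R * N. odd (c div 2 ^ y) \<and> odd (y div R div n div 2 ^ j)) * 2 ^ j))) * 2 ^ c])"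

lemma set_encode_eq_sum_of_bool:
  assumes "\<And>i. P i \<Longrightarrow> i < n"
  shows "set_encode {i. P i} = (\<Sum>i<n. of_bool (P i) * 2 ^ i)"
proof -
  have "{i. P i} = {i \<in> {..<n}. P i}"
    using assms by auto
  then have "set_encode {i. P i} = (\<Sum>i<n. if P i then 2 ^ i else 0)"
    by (simp only: set_encode_def sum.inter_filter finite_lessThan)
  also have "\<dots> = (\<Sum>i<n. of_bool (P i) * 2 ^ i)"
    by (intro sum.cong) auto
  finally show ?thesis .
qed

lemma product_code_muller_code:
  assumes A: "muller_automaton {..<k1} A" "mstates A = {..<n}"
  shows "product_code k2 (muller_code k1 A) t = muller_code k2 (product_automaton n A t)"
proof -
  define R where "R = code_nth t 0"
  let ?N = "n * 2 ^ n"
  let ?U = "\<lambda>F. {j. j < n \<and> (\<exists>y\<in>F. j \<in> visited n R y)}"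
  have acc_A: "macc A \<subseteq> Pow {..<n}"
    using A by (auto simp: muller_automaton_def)
  \<comment> \<open>The family is coded in two layers, so membership of \<open>F\<close> is the bit
    at position \<open>set_encode F\<close>. Finiteness is required for the injectivity of
    \<open>set_encode\<close>.\<close>
  have in_acc: "odd (set_encode (set_encode ` macc A) div 2 ^ set_encode F) \<longleftrightarrow> F \<in> macc A" if "finite F" for F
  proof -
    have "finite (set_encode ` macc A)"
      using acc_A by (auto intro: finite_subset)
    then have "odd (set_encode (set_encode ` macc A) div 2 ^ set_encode F) \<longleftrightarrow> set_encode F \<in> set_encode ` macc A"
      by (metis set_decode_def set_encode_inverse mem_Collect_eq)
    also have "\<dots> \<longleftrightarrow> F \<in> macc A"
      using that acc_A by (auto simp: set_encode_eq finite_subset[OF _ finite_lessThan])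
    finally show ?thesis .
  qed
  \<comment> \<open>Subsets of \<open>{..<R * ?N}\<close> correspond to numbers below
    \<open>2 ^ (R * ?N)\<close>, with \<open>set_decode\<close> as the inverse.\<close>
  have "set_encode ` {F. F \<subseteq> {..<R * ?N} \<and> ?U F \<in> macc A} =
      {c. c < 2 ^ (R * ?N) \<and> ?U (set_decode c) \<in> macc A}"
  proof (intro equalityI subsetI)
    fix c assume "c \<in> set_encode ` {F. F \<subseteq> {..<R * ?N} \<and> ?U F \<in> macc A}"
    then obtain F where F: "c = set_encode F" "F \<subseteq> {..<R * ?N}" "?U F \<in> macc A"
      by auto
    moreover have "finite F"
      using F(2) by (rule finite_subset) simp
    ultimately show "c \<in> {c. c < 2 ^ (R * ?N) \<and> ?U (set_decode c) \<in> macc A}"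
      by (simp flip: set_decode_subset_lessThan_iff)
  next
    fix c assume "c \<in> {c. c < 2 ^ (R * ?N) \<and> ?U (set_decode c) \<in> macc A}"
    then show "c \<in> set_encode ` {F. F \<subseteq> {..<R * ?N} \<and> ?U F \<in> macc A}"
      by (intro image_eqI[where x = "set_decode c"]) (simp_all add: set_decode_subset_lessThan_iff)
  qed
  moreover have "macc (product_automaton n A t) = {F. F \<subseteq> {..<R * ?N} \<and> ?U F \<in> macc A}"
    by (simp add: product_automaton_def R_def Let_def)
  ultimately have "set_encode (set_encode ` macc (product_automaton n A t)) =
      (\<Sum>c<2 ^ (R * ?N). of_bool (c < 2 ^ (R * ?N) \<and> ?U (set_decode c) \<in> macc A) * 2 ^ c)"
    by (simp only:) (rule set_encode_eq_sum_of_bool, simp)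
  also have "\<dots> = (\<Sum>c<2 ^ (R * ?N). of_bool (odd (set_encode (set_encode ` macc A) div
             2 ^ (\<Sum>j<n. of_bool (\<exists>y<R * ?N. odd (c div 2 ^ y) \<and> odd (y div R div n div 2 ^ j)) * 2 ^ j))) * 2 ^ c)"
  proof (intro sum.cong refl arg_cong2[where f = "(*)"] arg_cong[where f = of_bool])
    fix c assume c: "c \<in> {..<2 ^ (R * ?N) :: nat}"
    then have "set_decode c \<subseteq> {..<R * ?N}"
      by (simp add: set_decode_subset_lessThan_iff)
    then have U: "?U (set_decode c) = {j. j < n \<and> (\<exists>y<R * ?N. odd (c div 2 ^ y) \<and> odd (y div R div n div 2 ^ j))}"
      by (auto simp: visited_def set_decode_def)
    have "set_encode (?U (set_decode c)) =
        (\<Sum>j<n. of_bool (\<exists>y<R * ?N. odd (c div 2 ^ y) \<and> odd (y div R div n div 2 ^ j)) * 2 ^ j)"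
      unfolding U by (subst set_encode_eq_sum_of_bool[where n = n]) auto
    note sum_eq = this[symmetric]
    show "(c < 2 ^ (R * ?N) \<and> ?U (set_decode c) \<in> macc A) =
      odd (set_encode (set_encode ` macc A) div
             2 ^ (\<Sum>j<n. of_bool (\<exists>y<R * ?N. odd (c div 2 ^ y) \<and> odd (y div R div n div 2 ^ j)) * 2 ^ j))"
      unfolding sum_eq using c by (subst in_acc) simp_all
  qed
  finally show ?thesis
    using A by (simp add: product_code_def muller_code_def[of k2] muller_code_nth R_def Let_def
        product_automaton_def)
qed

text \<open>Every entry increases the code by at least one. A list code can therefore bound a loop
  over its list.\<close>

lemma length_le_list_encode: "length xs \<le> list_encode xs"
proof (induction xs)
  case (Cons x xs)
  then show ?case
    using le_prod_encode_2[of "list_encode xs" x] by simp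
qed simp

text \<open>The loop runs \<open>u\<close> rounds, which suffices for the whole list; once
  \<open>code_drop i u\<close> is 0, the list is exhausted and the remaining rounds change
  nothing.\<close>

lemma eval_digits_eq_rec_nat:
  "eval_digits N u x =
     rec_nat x (\<lambda>i y. if code_drop i u = 0 then y else digit N (code_nth u i) y) u"
proof -
  define us where "us = list_decode u"
  have u: "u = list_encode us"
    by (simp add: us_def)
  have "rec_nat x (\<lambda>i y. if code_drop i u = 0 then y else digit N (code_nth u i) y) m =
      fold (digit N) (take m us) x" for m
  proof (induction m)
    case (Suc m)
    have "code_drop m u = 0 \<longleftrightarrow> length us \<le> m"
      using list_encode_eq[of "drop m us" "[]"] by (simp add: u code_drop_list_encode)
    with Suc show ?case
      by (auto simp: u code_nth_list_encode take_Suc_conv_app_nth not_le)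
  qed simp
  then show ?thesis
    using length_le_list_encode[of us] by (simp add: eval_digits_def flip: us_def u)
qed

section \<open>Primitive recursiveness of the construction\<close>

lemma prec_digit [prec_intros]:
  assumes "prec v a" and "prec v b" and "prec v c"
  shows "prec v (\<lambda>e. digit (a e) (b e) (c e))"
  unfolding digit_def by (rule assms prec_intros)+

lemma prec_tabulate [prec_intros]:
  assumes "prec v N" and "prec (\<lambda>p. fst p # v (snd p)) (\<lambda>p. g (fst p) (snd p))"
  shows "prec v (\<lambda>e. tabulate (N e) (\<lambda>x. g x e))"
proof -
  note [prec_intros] = assms(1)[THEN prec_reindex]
    assms(1)[THEN prec_imp_uniform_length, THEN uniform_length_reindex]
  show ?thesis
    unfolding tabulate_def by (rule assms(2) prec_var_hd prec_intros | rule prec_var_tl)+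
qed

lemma prec_visit [prec_intros]:
  assumes "prec v a" and "prec v b" and "prec v c"
  shows "prec v (\<lambda>e. visit (a e) (b e) (c e))"
  unfolding visit_def add_bit_def by (rule assms prec_imp_uniform_length[OF assms(1)] prec_intros)+

lemma prec_eval_digits [prec_intros]:
  assumes "prec v a" and "prec v b" and "prec v c"
  shows "prec v (\<lambda>e. eval_digits (a e) (b e) (c e))"
proof -
  note [prec_intros] = assms[THEN prec_reindex]
    assms(1)[THEN prec_imp_uniform_length, THEN uniform_length_reindex]
  show ?thesis
    unfolding eval_digits_eq_rec_nat by (rule prec_var_hd prec_intros | rule prec_var_tl)+
qed

lemma prec_product_step [prec_intros]:
  assumes "prec v a" and "prec v b" and "prec v c" and "prec v d" and "prec v f"
  shows "prec v (\<lambda>e. product_step (a e) (b e) (c e) (d e) (f e))"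
  unfolding product_step_def by (rule assms prec_imp_uniform_length[OF assms(1)] prec_intros)+

lemma prec_transition_code:
  "prec (\<lambda>p. [fst p, snd p]) (\<lambda>p. transition_code (fst p) (snd p))"
  unfolding transition_code_def Let_def by (rule prec_var_hd prec_intros | rule prec_var_tl)+

lemma prec_product_code:
  "prec (\<lambda>p. [fst p, fst (snd p), snd (snd p)]) (\<lambda>p. product_code (fst p) (fst (snd p)) (snd (snd p)))"
  unfolding product_code_def Let_def by (rule prec_var_hd prec_intros | rule prec_var_tl)+

lemma computes_Comp:
  assumes "list_all2 (\<lambda>g y. computes orcs g xs y) gs ys" and "computes orcs f ys z"
  shows "computes orcs (Comp f gs) xs z"
  using assms by (auto simp: list_all2_conv_all_nth intro: computes.Comp[where ys = ys])

theorem theorem3p8: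
  shows "\<exists>p :: recf.
    \<forall>(k1 :: nat) (k2 :: nat) (\<alpha> :: nat word) (\<beta> :: nat word)
      (n :: nat) (A :: (nat, nat) muller) (orc :: nat \<Rightarrow> nat).
      range \<alpha> \<subseteq> {..<k1} \<and> range \<beta> \<subseteq> {..<k2} \<and>
      muller_automaton {..<k1} A \<and> mstates A = {..<n} \<and>
      transducer_oracle k1 k2 \<alpha> \<beta> orc \<longrightarrow>
      (\<exists>(n' :: nat) (B :: (nat, nat) muller).
         muller_automaton {..<k2} B \<and> mstates B = {..<n'} \<and>
         computes [\<alpha>, \<beta>, orc] p [k1, k2, muller_code k1 A] (muller_code k2 B) \<and>
         (\<alpha> \<in> muller_lang {..<k1} A \<longleftrightarrow> \<beta> \<in> muller_lang {..<k2} B))"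
proof -
  obtain pt where pt: "\<And>orcs k a. computes orcs pt [k, a] (transition_code k a)"
    using prec_transition_code by (auto simp: prec_def)
  obtain pp where pp: "\<And>orcs k a t. computes orcs pp [k, a, t] (product_code k a t)"
    using prec_product_code by (auto simp: prec_def)
  \<comment> \<open>The arguments 0, 1, 2 are \<open>k1\<close>, \<open>k2\<close> and the code of
    the automaton; \<open>Oracle 2\<close> is \<open>orc\<close> in the list
    \<open>[\<alpha>, \<beta>, orc]\<close>.\<close>
  define p where "p = Comp pp [Proj 1, Proj 2, Comp (Oracle 2) [Comp pt [Proj 0, Proj 2]]]"
  have p: "computes [\<alpha>, \<beta>, orc] p [k1, k2, a] (product_code k2 a (orc (transition_code k1 a)))"
    for \<alpha> \<beta> orc k1 k2 a
  proof -
    let ?orcs = "[\<alpha>, \<beta>, orc]" and ?xs = "[k1, k2, a]"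
    have proj: "computes ?orcs (Proj 0) ?xs k1" "computes ?orcs (Proj 1) ?xs k2" "computes ?orcs (Proj 2) ?xs a"
      using computes.Proj[of 0 ?xs ?orcs] computes.Proj[of 1 ?xs ?orcs] computes.Proj[of 2 ?xs ?orcs]
      by simp_all
    have t: "computes ?orcs (Comp pt [Proj 0, Proj 2]) ?xs (transition_code k1 a)"
      by (rule computes_Comp[where ys = "[k1, a]"]) (simp_all only: list_all2_Cons list_all2_Nil proj pt simp_thms)
    have o: "computes ?orcs (Comp (Oracle 2) [Comp pt [Proj 0, Proj 2]]) ?xs (orc (transition_code k1 a))"
      by (rule computes_Comp[where ys = "[transition_code k1 a]"])
        (use t computes.Oracle[of 2 ?orcs] in simp_all)
    show ?thesis
      unfolding p_def
      by (rule computes_Comp[where ys = "[k2, a, orc (transition_code k1 a)]"])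
        (simp_all only: list_all2_Cons list_all2_Nil proj o pp simp_thms)
  qed
  show ?thesis
  proof (intro exI[of _ p] allI impI, elim conjE)
    fix k1 k2 :: nat and \<alpha> \<beta> :: "nat word" and n :: nat and A :: "(nat, nat) muller" and orc :: "nat \<Rightarrow> nat"
    assume \<alpha>: "range \<alpha> \<subseteq> {..<k1}" and \<beta>: "range \<beta> \<subseteq> {..<k2}"
      and A: "muller_automaton {..<k1} A" "mstates A = {..<n}"
      and orc: "transducer_oracle k1 k2 \<alpha> \<beta> orc"
    let ?N = "n * 2 ^ n"
    let ?M = "transformation_monoid ?N" and ?h = "action_morphism ?N (muller_visit A n)"
    have n: "0 < n"
      using A by (auto simp: muller_automaton_def)
    have "monoid ?M"
      using n by (intro monoid_transformation_monoid) simp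
    moreover have "carrier ?M = {..<?N ^ ?N}"
      by (simp add: transformation_monoid_def)
    moreover have "monoid_morphism {..<k1} ?M ?h"
      by (rule monoid_morphism_action_morphism) (rule muller_visit_less[OF A])
    ultimately obtain R T w where T: "finite_transducer {..<k2} (carrier ?M) T" "tstates T = {..<R}"
      and code: "orc (morphism_code k1 ?M ?h) = transducer_code k2 T"
      and w: "\<And>i. w i \<in> lists {..<k1}" "word_concat w = Some \<circ> \<alpha>"
        "transducer_output T \<beta> = Some \<circ> (\<lambda>i. ?h (w i))"
      using orc unfolding transducer_oracle_def by metis
    define B where "B = product_automaton n A (transducer_code k2 T)"
    have "computes [\<alpha>, \<beta>, orc] p [k1, k2, muller_code k1 A] (muller_code k2 B)"
      using p[of \<alpha> \<beta> orc k1 k2 "muller_code k1 A"]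
      by (simp add: transition_code_muller_code[OF A(2) n] code product_code_muller_code[OF A] B_def)
    moreover have "mstates B = {..<R * ?N}"
      using T by (simp add: B_def product_automaton_def transducer_code_nth)
    moreover note product_automaton_correct[OF A T \<alpha> \<beta> w, folded B_def]
    ultimately show "\<exists>n' B. muller_automaton {..<k2} B \<and> mstates B = {..<n'} \<and>
         computes [\<alpha>, \<beta>, orc] p [k1, k2, muller_code k1 A] (muller_code k2 B) \<and>
         (\<alpha> \<in> muller_lang {..<k1} A \<longleftrightarrow> \<beta> \<in> muller_lang {..<k2} B)"
      by blast
  qed
qed

end
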